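(* Let $(X,\mathcal B,\mu)$ be a separable probability space and let $T:X\to X$ be an invertible $\mu$-preserving transformation. Suppose that $T$ is weakly mixing, that $f_j$, $j=1,\dots,\ell$, are bounded measurable functions on $X$, and that $p_j,q_j$, $j=1,\dots,\ell$, are integers such that the $p_j$ are distinct (ordered without loss of generality as $p_1<p_2<\dots<p_\ell$) and the $q_j$ are arbitrary. Then $$\lim_{N\to\infty}\frac 1N\sum_{n=1}^N\prod_{j=1}^\ell T^{p_jn+q_jN}f_j=\prod_{j=1}^\ell\int f_j\,d\mu\quad\text{in } L^2(X,\mu).$$
   Context: Here $\ell$ is a positive integer. For a function $f$ on $X$ and $m\in\mathbb Z$, $T^mf$ denotes the function $T^mf(x)=f(T^mx)$. The transformation $T$ is weakly mixing if the product transformation $T\times T$ on $(X\times X,\mathcal B\times\mathcal B,\mu\times\mu)$ is ergodic.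
   Formalization: The integers p_j are additionally assumed to be nonzero; with ℓ = 1 and p_1 = 0 the L² distance of the average from the integral of f_1 is constant in N and nonzero for a non-constant f_1, so the statement as written fails. *)

theory Defs
  imports "HOL-Probability.Probability"
begin

text \<open>Separability in the sense of measure theory: the pseudometric \<open>\<mu>(A \<triangle> B)\<close> on the
  \<open>\<sigma>\<close>-algebra is separable.  Countably generated \<open>\<sigma>\<close>-algebras (e.g. Borel sets of Polish
  spaces) are covered.\<close>

definition separable_prob_space :: "'a measure \<Rightarrow> bool" where
  "separable_prob_space M \<longleftrightarrow> prob_space M \<and>
     (\<exists>C \<subseteq> sets M. countable C \<and>
        (\<forall>A \<in> sets M. \<forall>e > 0. \<exists>B \<in> C. measure M ((A - B) \<union> (B - A)) < e))"

definition measure_preserving_map :: "'a measure \<Rightarrow> ('a \<Rightarrow> 'a) \<Rightarrow> bool" where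
  "measure_preserving_map M T \<longleftrightarrow> T \<in> M \<rightarrow>\<^sub>M M \<and>
     (\<forall>A \<in> sets M. emeasure M (T -` A \<inter> space M) = emeasure M A)"

definition invertible_mp :: "'a measure \<Rightarrow> ('a \<Rightarrow> 'a) \<Rightarrow> bool" where
  "invertible_mp M T \<longleftrightarrow> measure_preserving_map M T \<and>
     bij_betw T (space M) (space M) \<and> the_inv_into (space M) T \<in> M \<rightarrow>\<^sub>M M"

definition ergodic_map :: "'a measure \<Rightarrow> ('a \<Rightarrow> 'a) \<Rightarrow> bool" where
  "ergodic_map M T \<longleftrightarrow> measure_preserving_map M T \<and>
     (\<forall>A \<in> sets M. T -` A \<inter> space M = A \<longrightarrow> measure M A = 0 \<or> measure M A = 1)"

definition weakly_mixing :: "'a measure \<Rightarrow> ('a \<Rightarrow> 'a) \<Rightarrow> bool" where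
  "weakly_mixing M T \<longleftrightarrow> ergodic_map (M \<Otimes>\<^sub>M M) (map_prod T T)"

text \<open>Integer iterates; only meaningful on \<open>space M\<close>, on which \<open>T\<close> is a bijection.\<close>

definition iter_int :: "'a measure \<Rightarrow> ('a \<Rightarrow> 'a) \<Rightarrow> int \<Rightarrow> 'a \<Rightarrow> 'a" where
  "iter_int M T m x =
     (if 0 \<le> m then (T ^^ nat m) x else (the_inv_into (space M) T ^^ nat (- m)) x)"

definition koopman :: "'a measure \<Rightarrow> ('a \<Rightarrow> 'a) \<Rightarrow> int \<Rightarrow> ('a \<Rightarrow> 'b) \<Rightarrow> 'a \<Rightarrow> 'b" where
  "koopman M T m f x = f (iter_int M T m x)"

definition bounded_measurable :: "'a measure \<Rightarrow> ('a \<Rightarrow> complex) \<Rightarrow> bool" where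
  "bounded_measurable M f \<longleftrightarrow> f \<in> borel_measurable M \<and> bounded (f ` space M)"

definition in_L2 :: "'a measure \<Rightarrow> ('a \<Rightarrow> complex) \<Rightarrow> bool" where
  "in_L2 M f \<longleftrightarrow> f \<in> borel_measurable M \<and> integrable M (\<lambda>x. (norm (f x))\<^sup>2)"

definition L2_norm :: "'a measure \<Rightarrow> ('a \<Rightarrow> complex) \<Rightarrow> real" where
  "L2_norm M f = sqrt (\<integral>x. (norm (f x))\<^sup>2 \<partial>M)"

text \<open>Membership in \<open>L\<^sup>2\<close> is required explicitly because the Bochner integral of a
  non-integrable function is \<open>0\<close>.\<close>

definition converges_in_L2 ::
    "'a measure \<Rightarrow> (nat \<Rightarrow> 'a \<Rightarrow> complex) \<Rightarrow> ('a \<Rightarrow> complex) \<Rightarrow> bool" where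
  "converges_in_L2 M F g \<longleftrightarrow> (\<forall>N. in_L2 M (F N)) \<and> in_L2 M g \<and>
     (\<lambda>N. L2_norm M (\<lambda>x. F N x - g x)) \<longlonglongrightarrow> 0"

end

theory Submission
  imports Defs
begin

text \<open>The proof is an induction on the set of indices \<open>j\<close>. In the step the function \<open>f k\<close> of a new
  index \<open>k\<close> is split into its mean, which leaves an average over fewer indices, and a function of
  mean zero, whose average has to vanish in the limit. For the latter the van der Corput
  inequality (\<open>van_der_Corput\<close>) reduces the mean square of an average to the limits of the
  correlations of two shifts \<open>h\<close> and \<open>h'\<close> of the summands. Because \<open>T\<close> preserves the measure, the
  \<open>k\<close>-th factor of such a correlation can be made independent of \<open>n\<close> and \<open>N\<close>; what remains is an
  average over the old indices with exponents \<open>(p j - p k) n + (q j - q k) N\<close>. These differences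
  \<open>p j - p k\<close> are again distinct and nonzero, so the induction hypothesis computes the limit as a
  product of integrals. One of the factors is the correlation of \<open>f k\<close> with itself at distance
  \<open>p k (h - h')\<close>, and averaging over \<open>h\<close> and \<open>h'\<close> below \<open>H\<close> makes it small
  (\<open>weakly_mixing_correlations\<close>). Here \<open>p k\<close> must be nonzero.

  That self-correlations are small on average is the way weak mixing enters. The averaged squared
  correlations of \<open>f\<close> are the mean square of the ergodic averages of \<open>f x * cnj (f y)\<close> under
  \<open>T \<times> T\<close>, which is ergodic; hence the ergodic theorem for bounded functions finishes the argument.
  It is obtained pointwise, from the maximal inequality \<open>maximal_ergodic\<close>, and
  then transferred to mean square by bounded convergence.\<close>

section \<open>Bounded measurable functions and measure preserving maps\<close>

lemma bounded_measurableI: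
  "f \<in> borel_measurable M \<Longrightarrow> (\<And>x. x \<in> space M \<Longrightarrow> norm (f x) \<le> B) \<Longrightarrow> bounded_measurable M f"
  unfolding bounded_measurable_def bounded_iff by auto

lemma bounded_measurable_imp_measurable [measurable_dest]:
  "bounded_measurable M f \<Longrightarrow> f \<in> borel_measurable M"
  unfolding bounded_measurable_def by blast

lemma bounded_measurable_bound:
  assumes "bounded_measurable M f"
  obtains B where "0 < B" "\<And>x. x \<in> space M \<Longrightarrow> norm (f x) \<le> B"
  using assms unfolding bounded_measurable_def bounded_pos by auto

lemma bounded_measurable_const: "bounded_measurable M (\<lambda>x. c)"
  by (rule bounded_measurableI[where B = "norm c"]) auto

lemma borel_measurable_cnj [measurable (raw)]:
  "f \<in> borel_measurable M \<Longrightarrow> (\<lambda>x. cnj (f x)) \<in> borel_measurable M"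
  using borel_measurable_continuous_on[of cnj f M] by (simp add: continuous_on_cnj)

lemma bounded_measurable_cnj:
  assumes "bounded_measurable M f"
  shows "bounded_measurable M (\<lambda>x. cnj (f x))"
proof -
  obtain B where "\<And>x. x \<in> space M \<Longrightarrow> norm (f x) \<le> B"
    using bounded_measurable_bound[OF assms] by auto
  then show ?thesis
    using assms by (intro bounded_measurableI[where B = B]) auto
qed

lemma bounded_measurable_mult:
  assumes "bounded_measurable M f" "bounded_measurable M g"
  shows "bounded_measurable M (\<lambda>x. f x * g x)"
proof -
  obtain A where A: "0 < A" "\<And>x. x \<in> space M \<Longrightarrow> norm (f x) \<le> A"
    using bounded_measurable_bound[OF assms(1)] by auto
  obtain B where "\<And>x. x \<in> space M \<Longrightarrow> norm (g x) \<le> B"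
    using bounded_measurable_bound[OF assms(2)] by auto
  with A show ?thesis
    using assms by (intro bounded_measurableI[where B = "A * B"]) (auto simp: norm_mult intro!: mult_mono)
qed

lemma bounded_measurable_add:
  assumes "bounded_measurable M f" "bounded_measurable M g"
  shows "bounded_measurable M (\<lambda>x. f x + g x)"
proof -
  obtain A where A: "0 < A" "\<And>x. x \<in> space M \<Longrightarrow> norm (f x) \<le> A"
    using bounded_measurable_bound[OF assms(1)] by auto
  obtain B where "\<And>x. x \<in> space M \<Longrightarrow> norm (g x) \<le> B"
    using bounded_measurable_bound[OF assms(2)] by auto
  with A show ?thesis
    using assms
    by (intro bounded_measurableI[where B = "A + B"]) (auto intro!: norm_triangle_le add_mono)
qed

lemma bounded_measurable_diff:
  assumes "bounded_measurable M f" "bounded_measurable M g"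
  shows "bounded_measurable M (\<lambda>x. f x - g x)"
  using bounded_measurable_add[OF assms(1) bounded_measurable_mult[OF bounded_measurable_const[of M "-1"] assms(2)]]
  by simp

lemma bounded_measurable_sum:
  assumes "finite I" "\<And>i. i \<in> I \<Longrightarrow> bounded_measurable M (f i)"
  shows "bounded_measurable M (\<lambda>x. \<Sum>i\<in>I. f i x)"
  using assms by (induction I) (auto intro!: bounded_measurable_add bounded_measurable_const)

lemma bounded_measurable_prod:
  assumes "finite I" "\<And>i. i \<in> I \<Longrightarrow> bounded_measurable M (f i)"
  shows "bounded_measurable M (\<lambda>x. \<Prod>i\<in>I. f i x)"
  using assms by (induction I) (auto intro!: bounded_measurable_mult bounded_measurable_const)

lemma bounded_measurable_comp:
  assumes "bounded_measurable M f" and [measurable]: "S \<in> N \<rightarrow>\<^sub>M M"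
  shows "bounded_measurable N (\<lambda>x. f (S x))"
proof -
  obtain B where "\<And>x. x \<in> space M \<Longrightarrow> norm (f x) \<le> B"
    using bounded_measurable_bound[OF assms(1)] by auto
  with measurable_space[OF assms(2)] show ?thesis
    using measurable_compose[OF assms(2) bounded_measurable_imp_measurable[OF assms(1)]]
    by (intro bounded_measurableI[where B = B]) auto
qed

lemmas bounded_measurable_intros = bounded_measurable_const bounded_measurable_cnj
  bounded_measurable_mult bounded_measurable_add bounded_measurable_diff
  bounded_measurable_sum bounded_measurable_prod

lemma (in prob_space) integrable_bounded_measurable:
  assumes "bounded_measurable M f"
  shows "integrable M f"
proof -
  obtain B where B: "\<And>x. x \<in> space M \<Longrightarrow> norm (f x) \<le> B"
    using bounded_measurable_bound[OF assms] by auto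
  then have "AE x in M. norm (f x) \<le> B" by (rule AE_I2)
  then show ?thesis
    using assms by (intro integrable_const_bound[where B = B]) auto
qed

lemma (in prob_space) integrable_norm_square:
  assumes "bounded_measurable M f"
  shows "integrable M (\<lambda>x. (norm (f x))\<^sup>2)"
proof -
  obtain B where B: "\<And>x. x \<in> space M \<Longrightarrow> norm (f x) \<le> B"
    using bounded_measurable_bound[OF assms] by auto
  then have "AE x in M. norm ((norm (f x))\<^sup>2) \<le> B\<^sup>2"
    by (intro AE_I2) (auto intro!: power_mono)
  then show ?thesis
    using assms by (intro integrable_const_bound[where B = "B\<^sup>2"]) auto
qed

lemma (in prob_space) norm_expectation_square_le:
  assumes "bounded_measurable M f"
  shows "(norm (\<integral>x. f x \<partial>M))\<^sup>2 \<le> (\<integral>x. (norm (f x))\<^sup>2 \<partial>M)"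
proof -
  have i: "integrable M (\<lambda>x. norm (f x))"
    using integrable_bounded_measurable[OF assms] by auto
  have "(norm (\<integral>x. f x \<partial>M))\<^sup>2 \<le> (\<integral>x. norm (f x) \<partial>M)\<^sup>2"
    by (intro power_mono) auto
  also have "\<dots> \<le> (\<integral>x. (norm (f x))\<^sup>2 \<partial>M)"
    using variance_positive[of "\<lambda>x. norm (f x)"] variance_eq[OF i integrable_norm_square[OF assms]]
    by simp
  finally show ?thesis .
qed

lemma measure_preserving_distr:
  assumes "measure_preserving_map M S"
  shows "distr M M S = M"
  using assms unfolding measure_preserving_map_def
  by (intro measure_eqI) (auto simp: emeasure_distr)

lemma measure_preserving_measurable:
  "measure_preserving_map M S \<Longrightarrow> S \<in> M \<rightarrow>\<^sub>M M"
  unfolding measure_preserving_map_def by blast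

lemma measure_preserving_integral:
  fixes f :: "'a \<Rightarrow> 'b::{banach, second_countable_topology}"
  assumes "measure_preserving_map M S" "f \<in> borel_measurable M"
  shows "(\<integral>x. f (S x) \<partial>M) = (\<integral>x. f x \<partial>M)"
  using integral_distr[OF measure_preserving_measurable[OF assms(1)] assms(2)]
  by (simp add: measure_preserving_distr[OF assms(1)])

lemma measure_preserving_integrable:
  fixes f :: "'a \<Rightarrow> 'b::{banach, second_countable_topology}"
  assumes "measure_preserving_map M S" "integrable M f"
  shows "integrable M (\<lambda>x. f (S x))"
proof -
  have "integrable (distr M M S) f"
    using assms(2) by (simp add: measure_preserving_distr[OF assms(1)])
  from integrable_distr[OF measure_preserving_measurable[OF assms(1)] this] show ?thesis .
qed

section \<open>The ergodic theorem for bounded functions\<close>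

definition birkhoff_sum :: "('a \<Rightarrow> 'a) \<Rightarrow> ('a \<Rightarrow> 'b::comm_monoid_add) \<Rightarrow> nat \<Rightarrow> 'a \<Rightarrow> 'b" where
  "birkhoff_sum S g n x = (\<Sum>i<n. g ((S ^^ i) x))"

lemma birkhoff_sum_Suc: "birkhoff_sum S g (Suc n) x = g x + birkhoff_sum S g n (S x)"
  unfolding birkhoff_sum_def
  by (subst sum.lessThan_Suc_shift) (simp add: funpow_Suc_right del: funpow.simps)

text \<open>The largest of the first \<open>n + 1\<close> Birkhoff sums, the empty one included.\<close>

primrec max_birkhoff_sum :: "('a \<Rightarrow> 'a) \<Rightarrow> ('a \<Rightarrow> real) \<Rightarrow> nat \<Rightarrow> 'a \<Rightarrow> real" where
  "max_birkhoff_sum S g 0 x = 0"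
| "max_birkhoff_sum S g (Suc n) x = max 0 (g x + max_birkhoff_sum S g n (S x))"

lemma birkhoff_sum_le_max: "birkhoff_sum S g n x \<le> max_birkhoff_sum S g n x"
proof (induction n arbitrary: x)
  case 0
  then show ?case by (simp add: birkhoff_sum_def)
next
  case (Suc n)
  show ?case using Suc[of "S x"] by (simp add: birkhoff_sum_Suc)
qed

lemma max_birkhoff_sum_nonneg: "0 \<le> max_birkhoff_sum S g n x"
  by (cases n) auto

lemma max_birkhoff_sum_mono: "max_birkhoff_sum S g n x \<le> max_birkhoff_sum S g (Suc n) x"
proof (induction n arbitrary: x)
  case 0
  then show ?case by simp
next
  case (Suc n)
  show ?case using Suc[of "S x"] by simp
qed

lemma max_birkhoff_sum_incseq: "m \<le> n \<Longrightarrow> max_birkhoff_sum S g m x \<le> max_birkhoff_sum S g n x"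
  using lift_Suc_mono_le[of "\<lambda>n. max_birkhoff_sum S g n x"] max_birkhoff_sum_mono by metis

lemma max_birkhoff_sum_integrable:
  assumes S: "measure_preserving_map M S" and g: "integrable M g"
  shows "integrable M (max_birkhoff_sum S g n)"
proof (induction n)
  case 0
  have "max_birkhoff_sum S g 0 = (\<lambda>x. 0)" by auto
  then show ?case by simp
next
  case (Suc n)
  have "max_birkhoff_sum S g (Suc n) = (\<lambda>x. max 0 (g x + max_birkhoff_sum S g n (S x)))" by auto
  then show ?case
    using measure_preserving_integrable[OF S Suc] g by simp
qed

text \<open>Garsia's argument: where the maximal sum \<open>M\<^sub>n\<close> is positive, it exceeds \<open>M\<^sub>n \<circ> S\<close> by at
  most \<open>g\<close>, and elsewhere it is at most \<open>M\<^sub>n \<circ> S\<close>. Both functions have the same integral, so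
  \<open>g\<close> has a nonnegative integral over the set where \<open>M\<^sub>n\<close> is positive. By hypothesis these sets
  increase to a set of full measure.\<close>

lemma maximal_ergodic:
  fixes g :: "'a \<Rightarrow> real"
  assumes S: "measure_preserving_map M S" and g: "integrable M g"
    and pos: "AE x in M. \<exists>n. 0 < birkhoff_sum S g n x"
  shows "0 \<le> (\<integral>x. g x \<partial>M)"
proof -
  let ?M = "max_birkhoff_sum S g"
  let ?I = "\<lambda>n x. if 0 < ?M n x then g x else 0"
  note [measurable] = borel_measurable_integrable[OF g]
    borel_measurable_integrable[OF max_birkhoff_sum_integrable[OF S g]]
  have int: "integrable M (?I n)" for n
    by (rule Bochner_Integration.integrable_bound[OF g]) auto
  have le: "?M n x - ?M n (S x) \<le> ?I n x" for n x
  proof (cases n)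
    case (Suc m)
    then show ?thesis
      using max_birkhoff_sum_mono[of S g m "S x"] max_birkhoff_sum_nonneg[of S g n "S x"]
      by (auto simp: max_def)
  qed auto
  have nonneg: "0 \<le> (\<integral>x. ?I n x \<partial>M)" for n
  proof -
    note i = max_birkhoff_sum_integrable[OF S g, of n]
    have "0 = (\<integral>x. ?M n x - ?M n (S x) \<partial>M)"
      using i measure_preserving_integrable[OF S i] measure_preserving_integral[OF S, of "?M n"]
      by (simp add: borel_measurable_integrable)
    also have "\<dots> \<le> (\<integral>x. ?I n x \<partial>M)"
      by (rule integral_mono[OF _ int le]) (intro Bochner_Integration.integrable_diff i measure_preserving_integrable[OF S i])
    finally show ?thesis .
  qed
  have "(\<lambda>n. \<integral>x. ?I n x \<partial>M) \<longlonglongrightarrow> (\<integral>x. g x \<partial>M)"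
  proof (rule integral_dominated_convergence[where w = "\<lambda>x. norm (g x)"])
    show "AE x in M. (\<lambda>n. ?I n x) \<longlonglongrightarrow> g x"
      using pos
    proof eventually_elim
      case (elim x)
      then obtain n where "0 < birkhoff_sum S g n x" by blast
      then have "0 < ?M k x" if "k \<ge> n" for k
        using birkhoff_sum_le_max[of S g n x] max_birkhoff_sum_incseq[OF that, of S g x] by linarith
      then have "eventually (\<lambda>k. ?I k x = g x) sequentially"
        unfolding eventually_sequentially by auto
      then show ?case by (rule tendsto_eventually)
    qed
  qed (use g in auto)
  then show ?thesis
    by (rule LIMSEQ_le_const) (use nonneg in blast)
qed

lemma birkhoff_sum_measurable:
  fixes g :: "'a \<Rightarrow> 'b::{second_countable_topology, topological_comm_monoid_add}"
  assumes [measurable]: "S \<in> M \<rightarrow>\<^sub>M M" "g \<in> borel_measurable M"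
  shows "birkhoff_sum S g n \<in> borel_measurable M"
proof -
  have [measurable]: "(S ^^ i) \<in> M \<rightarrow>\<^sub>M M" for i
    by (induction i) auto
  show ?thesis unfolding birkhoff_sum_def by measurable
qed

text \<open>The points with unbounded Birkhoff sums form a strictly invariant set, so this set has
  measure zero or one; measure one would contradict the maximal inequality.\<close>

lemma ergodic_birkhoff_sum_bounded_above:
  fixes g :: "'a \<Rightarrow> real"
  assumes "prob_space M" and erg: "ergodic_map M S" and g: "integrable M g"
    and neg: "(\<integral>x. g x \<partial>M) < 0"
  shows "AE x in M. \<exists>K::nat. \<forall>n. birkhoff_sum S g n x \<le> real K"
proof -
  interpret prob_space M by fact
  have S: "measure_preserving_map M S"
    using erg unfolding ergodic_map_def by blast
  note [measurable] = measure_preserving_measurable[OF S] borel_measurable_integrable[OF g]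
    birkhoff_sum_measurable
  define E where "E = {x \<in> space M. \<forall>K::nat. \<exists>n. real K < birkhoff_sum S g n x}"
  have E [measurable]: "E \<in> sets M" unfolding E_def by measurable
  have "(\<forall>K::nat. \<exists>n. real K < birkhoff_sum S g n (S x)) \<longleftrightarrow>
        (\<forall>K::nat. \<exists>n. real K < birkhoff_sum S g n x)" (is "?L \<longleftrightarrow> ?R") for x
  proof
    assume L: ?L
    show ?R
    proof
      fix K :: nat
      obtain n where "real (K + nat \<lceil>\<bar>g x\<bar>\<rceil>) < birkhoff_sum S g n (S x)" using L by blast
      then have "real K < birkhoff_sum S g (Suc n) x"
        unfolding birkhoff_sum_Suc by linarith
      then show "\<exists>n. real K < birkhoff_sum S g n x" by blast
    qed
  next
    assume R: ?R
    show ?L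
    proof
      fix K :: nat
      obtain n where n: "real (K + nat \<lceil>\<bar>g x\<bar>\<rceil>) < birkhoff_sum S g n x" using R by blast
      then obtain m where m: "n = Suc m"
        by (cases n) (auto simp: birkhoff_sum_def simp del: of_nat_add)
      have "real K < birkhoff_sum S g m (S x)"
        using n unfolding m birkhoff_sum_Suc by linarith
      then show "\<exists>n. real K < birkhoff_sum S g n (S x)" by blast
    qed
  qed
  then have "S -` E \<inter> space M = E"
    unfolding E_def using measurable_space[OF measure_preserving_measurable[OF S]] by auto
  then have "prob E = 0 \<or> prob E = 1"
    using erg E unfolding ergodic_map_def by blast
  moreover have False if "prob E = 1"
  proof -
    have "AE x in M. x \<in> E" using that E by (simp add: prob_eq_1)
    then have "AE x in M. \<exists>n. 0 < birkhoff_sum S g n x"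
    proof (eventually_elim)
      case (elim x)
      then have "\<exists>n. real 0 < birkhoff_sum S g n x" unfolding E_def by blast
      then show ?case by simp
    qed
    from maximal_ergodic[OF S g this] neg show False by simp
  qed
  ultimately have "AE x in M. x \<notin> E" using E by (auto simp: prob_eq_0)
  then show ?thesis
    by (rule AE_mp) (auto simp: E_def not_less intro!: AE_I2)
qed

text \<open>Lowering \<open>g\<close> by \<open>1 / (k + 1)\<close> makes its integral negative, and bounded Birkhoff sums of the
  lowered function mean that the averages of \<open>g\<close> itself exceed \<open>1 / (k + 1)\<close> by \<open>O(1 / n)\<close> at most.\<close>

lemma ergodic_birkhoff_sum_le:
  fixes g :: "'a \<Rightarrow> real"
  assumes "prob_space M" and erg: "ergodic_map M S" and g: "integrable M g"
    and zero: "(\<integral>x. g x \<partial>M) = 0"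
  shows "AE x in M. \<forall>k::nat. \<exists>K::nat. \<forall>n. birkhoff_sum S g n x \<le> real n / real (Suc k) + real K"
  unfolding AE_all_countable
proof
  fix k :: nat
  interpret prob_space M by fact
  have "(\<integral>x. g x - 1 / real (Suc k) \<partial>M) = - (1 / real (Suc k))"
    using g zero by (simp add: prob_space)
  then have "AE x in M. \<exists>K::nat. \<forall>n. birkhoff_sum S (\<lambda>x. g x - 1 / real (Suc k)) n x \<le> real K"
    using g by (intro ergodic_birkhoff_sum_bounded_above[OF assms(1) erg]) auto
  moreover have "birkhoff_sum S (\<lambda>x. g x - 1 / real (Suc k)) n x
      = birkhoff_sum S g n x - real n / real (Suc k)" for n x
    unfolding birkhoff_sum_def by (simp add: sum_subtractf)
  ultimately show "AE x in M. \<exists>K::nat. \<forall>n. birkhoff_sum S g n x \<le> real n / real (Suc k) + real K"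
    by (simp add: diff_le_eq add.commute)
qed

lemma ergodic_average_tendsto_0_real:
  fixes g :: "'a \<Rightarrow> real"
  assumes "prob_space M" and erg: "ergodic_map M S" and g: "integrable M g"
    and zero: "(\<integral>x. g x \<partial>M) = 0"
  shows "AE x in M. (\<lambda>n. birkhoff_sum S g n x / real n) \<longlonglongrightarrow> 0"
proof -
  have neg: "birkhoff_sum S (\<lambda>x. - g x) n x = - birkhoff_sum S g n x" for n x
    unfolding birkhoff_sum_def by (simp add: sum_negf)
  have 1: "AE x in M. \<forall>k::nat. \<exists>K::nat. \<forall>n. birkhoff_sum S g n x \<le> real n / real (Suc k) + real K"
    by (rule ergodic_birkhoff_sum_le[OF assms])
  have 2: "AE x in M. \<forall>k::nat. \<exists>K::nat. \<forall>n. - birkhoff_sum S g n x \<le> real n / real (Suc k) + real K"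
    using ergodic_birkhoff_sum_le[of M S "\<lambda>x. - g x"] assms unfolding neg by simp
  from 1 2 show ?thesis
  proof eventually_elim
    case (elim x)
    show ?case
    proof (rule LIMSEQ_I)
      fix e :: real assume "e > 0"
      then obtain k :: nat where k: "1 / real (Suc k) < e / 2"
        using nat_approx_posE[of "e/2"] by auto
      obtain K :: nat where K: "\<And>n. birkhoff_sum S g n x \<le> real n / real (Suc k) + real K"
        using elim(1) by blast
      obtain L :: nat where L: "\<And>n. - birkhoff_sum S g n x \<le> real n / real (Suc k) + real L"
        using elim(2) by blast
      obtain N :: nat where N: "2 * real (K + L + 1) / e < real N"
        using reals_Archimedean2 by blast
      have "norm (birkhoff_sum S g n x / real n - 0) < e" if "n \<ge> N" for n
      proof -
        have "2 * real (K + L + 1) / e < real n" using N that by linarith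
        then have n2: "real (K + L + 1) < real n * (e / 2)"
          using \<open>e > 0\<close> by (simp add: field_simps)
        then have n0: "0 < n" by (cases n) auto
        have "real n / real (Suc k) \<le> real n * (e / 2)"
          using k mult_left_mono[of "1 / real (Suc k)" "e/2" "real n"] by simp
        then have "\<bar>birkhoff_sum S g n x\<bar> < real n * e"
          using K[of n] L[of n] n2 by linarith
        then show ?thesis using n0 by (simp add: field_simps)
      qed
      then show "\<exists>N. \<forall>n\<ge>N. norm (birkhoff_sum S g n x / real n - 0) < e" by blast
    qed
  qed
qed

text \<open>Passing from almost everywhere convergence to convergence in mean square only needs
  bounded convergence, as averages of a bounded function are uniformly bounded.\<close>

lemma ergodic_mean_square_tendsto_0:
  assumes "prob_space M" and erg: "ergodic_map M S" and g: "bounded_measurable M g"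
    and zero: "(\<integral>x. g x \<partial>M) = 0"
  shows "(\<lambda>n. \<integral>x. (norm (birkhoff_sum S g n x / of_nat n))\<^sup>2 \<partial>M) \<longlonglongrightarrow> 0"
proof -
  interpret prob_space M by fact
  have S: "measure_preserving_map M S"
    using erg unfolding ergodic_map_def by blast
  note [measurable] = measure_preserving_measurable[OF S] birkhoff_sum_measurable
    bounded_measurable_imp_measurable[OF g]
  note i = integrable_bounded_measurable[OF g]
  obtain B where B: "0 < B" "\<And>x. x \<in> space M \<Longrightarrow> norm (g x) \<le> B"
    using bounded_measurable_bound[OF g] by blast
  have "AE x in M. (\<lambda>n. birkhoff_sum S (\<lambda>x. Re (g x)) n x / real n) \<longlonglongrightarrow> 0"
    by (rule ergodic_average_tendsto_0_real[OF assms(1) erg]) (use i zero in auto)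
  moreover have "AE x in M. (\<lambda>n. birkhoff_sum S (\<lambda>x. Im (g x)) n x / real n) \<longlonglongrightarrow> 0"
    by (rule ergodic_average_tendsto_0_real[OF assms(1) erg]) (use i zero in auto)
  ultimately have lim: "AE x in M. (\<lambda>n. birkhoff_sum S g n x / of_nat n) \<longlonglongrightarrow> 0"
  proof eventually_elim
    case (elim x)
    have "birkhoff_sum S g n x / of_nat n = Complex (birkhoff_sum S (\<lambda>x. Re (g x)) n x / real n)
       (birkhoff_sum S (\<lambda>x. Im (g x)) n x / real n)" for n
      unfolding birkhoff_sum_def by (simp add: complex_eq_iff)
    with tendsto_Complex[OF elim] show ?case by (simp flip: zero_complex.code)
  qed
  have S_space: "(S ^^ i) x \<in> space M" if "x \<in> space M" for i x
    by (induction i) (use that measurable_space[OF measure_preserving_measurable[OF S]] in auto)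
  have bound: "norm (birkhoff_sum S g n x / of_nat n) \<le> B" if "x \<in> space M" for n x
  proof -
    have "norm (birkhoff_sum S g n x) \<le> (\<Sum>i<n. B)"
      unfolding birkhoff_sum_def by (intro sum_norm_le) (auto intro!: B S_space that)
    then show ?thesis using B(1) by (cases "n = 0") (auto simp: norm_divide field_simps)
  qed
  have "(\<lambda>n. \<integral>x. (norm (birkhoff_sum S g n x / of_nat n))\<^sup>2 \<partial>M) \<longlonglongrightarrow> (\<integral>x. 0 \<partial>M)"
  proof (rule integral_dominated_convergence[where w = "\<lambda>x. B\<^sup>2"])
    show "AE x in M. (\<lambda>n. (norm (birkhoff_sum S g n x / of_nat n))\<^sup>2) \<longlonglongrightarrow> 0"
      using lim
    proof eventually_elim
      case (elim x)
      from tendsto_power[OF tendsto_norm[OF elim], of 2] show ?case by simp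
    qed
    show "AE x in M. norm ((norm (birkhoff_sum S g n x / of_nat n))\<^sup>2) \<le> B\<^sup>2" for n
      by (intro AE_I2) (use bound in \<open>auto intro!: power_mono\<close>)
  qed auto
  then show ?thesis by simp
qed

section \<open>Correlations of a weakly mixing transformation\<close>

lemma measure_preserving_comp:
  assumes R: "measure_preserving_map M R" and S: "measure_preserving_map M S"
  shows "measure_preserving_map M (\<lambda>x. R (S x))"
  unfolding measure_preserving_map_def
proof (intro conjI ballI)
  note [measurable] = measure_preserving_measurable[OF R] measure_preserving_measurable[OF S]
  show "(\<lambda>x. R (S x)) \<in> M \<rightarrow>\<^sub>M M" by measurable
  fix A assume A [measurable]: "A \<in> sets M"
  have "(\<lambda>x. R (S x)) -` A \<inter> space M = S -` (R -` A \<inter> space M) \<inter> space M"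
    using measurable_space[OF measure_preserving_measurable[OF S]] by auto
  moreover have "R -` A \<inter> space M \<in> sets M" by measurable
  ultimately show "emeasure M ((\<lambda>x. R (S x)) -` A \<inter> space M) = emeasure M A"
    using R S A unfolding measure_preserving_map_def by metis
qed

lemma measure_preserving_funpow:
  assumes "measure_preserving_map M S"
  shows "measure_preserving_map M (S ^^ n)"
proof (induction n)
  case 0
  then show ?case unfolding measure_preserving_map_def
    by (auto simp: sets.Int_space_eq2)
next
  case (Suc n)
  from measure_preserving_comp[OF assms Suc] show ?case by (simp add: comp_def)
qed

lemma (in prob_space) integral_pair_product:
  assumes u: "bounded_measurable M u" and v: "bounded_measurable M v"
  shows "(\<integral>z. u (fst z) * v (snd z) \<partial>(M \<Otimes>\<^sub>M M)) = (\<integral>x. u x \<partial>M) * (\<integral>x. v x \<partial>M)"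
proof -
  interpret P: pair_prob_space M M ..
  have "bounded_measurable (M \<Otimes>\<^sub>M M) (\<lambda>z. u (fst z) * v (snd z))"
    by (intro bounded_measurable_mult bounded_measurable_comp[OF u] bounded_measurable_comp[OF v]) auto
  from P.integral_fst'[OF P.integrable_bounded_measurable[OF this]] show ?thesis by simp
qed

text \<open>The product \<open>G x y = f x * cnj (f y)\<close> has integral zero, so weak mixing makes its ergodic
  averages under \<open>T \<times> T\<close> vanish in mean square; expanding that square and applying Fubini gives
  exactly the average of the squared correlations of \<open>f\<close>.\<close>

lemma weakly_mixing_square_correlations:
  assumes "prob_space M" and T: "measure_preserving_map M T" and wm: "weakly_mixing M T"
    and f: "bounded_measurable M f" and zero: "(\<integral>x. f x \<partial>M) = 0"
  shows "(\<lambda>H. (\<Sum>(m, n)\<in>{..<H} \<times> {..<H}.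
      (norm (\<integral>x. f ((T ^^ m) x) * cnj (f ((T ^^ n) x)) \<partial>M))\<^sup>2) / (real H)\<^sup>2) \<longlonglongrightarrow> 0"
proof -
  interpret prob_space M by fact
  interpret P: pair_prob_space M M ..
  define S where "S = map_prod T T"
  define G where "G = (\<lambda>z. f (fst z) * cnj (f (snd z)))"
  define k where "k = (\<lambda>m n x. f ((T ^^ m) x) * cnj (f ((T ^^ n) x)))"
  have fT: "bounded_measurable M (\<lambda>x. f ((T ^^ m) x))" for m
    using measure_preserving_measurable[OF measure_preserving_funpow[OF T]]
    by (rule bounded_measurable_comp[OF f])
  have k: "bounded_measurable M (k m n)" for m n
    unfolding k_def by (intro bounded_measurable_intros fT)
  have G: "bounded_measurable (M \<Otimes>\<^sub>M M) G"
    unfolding G_def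
    by (intro bounded_measurable_mult bounded_measurable_cnj bounded_measurable_comp[OF f]) auto
  have "(\<integral>z. G z \<partial>(M \<Otimes>\<^sub>M M)) = 0"
    unfolding G_def integral_pair_product[OF f bounded_measurable_cnj[OF f]] using zero by simp
  then have lim: "(\<lambda>H. \<integral>z. (norm (birkhoff_sum S G H z / of_nat H))\<^sup>2 \<partial>(M \<Otimes>\<^sub>M M)) \<longlonglongrightarrow> 0"
    using wm unfolding weakly_mixing_def S_def
    by (intro ergodic_mean_square_tendsto_0[OF P.prob_space_axioms _ G])
  have "(\<integral>z. (norm (birkhoff_sum S G H z / of_nat H))\<^sup>2 \<partial>(M \<Otimes>\<^sub>M M))
      = (\<Sum>(m, n)\<in>{..<H} \<times> {..<H}. (norm (\<integral>x. k m n x \<partial>M))\<^sup>2) / (real H)\<^sup>2" for H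
  proof -
    have S: "(S ^^ m) z = ((T ^^ m) (fst z), (T ^^ m) (snd z))" for m z
      by (induction m) (auto simp: S_def)
    have "complex_of_real ((norm (birkhoff_sum S G H z))\<^sup>2)
        = (\<Sum>(m, n)\<in>{..<H} \<times> {..<H}. k m n (fst z) * cnj (k m n (snd z)))" for z
      unfolding complex_norm_square birkhoff_sum_def cnj_sum sum_product sum.cartesian_product
      by (simp add: S G_def k_def mult_ac)
    moreover have "integrable (M \<Otimes>\<^sub>M M) (\<lambda>z. k m n (fst z) * cnj (k m n (snd z)))" for m n
      by (intro P.integrable_bounded_measurable bounded_measurable_mult bounded_measurable_cnj
          bounded_measurable_comp[OF k]) auto
    ultimately have "(\<integral>z. complex_of_real ((norm (birkhoff_sum S G H z))\<^sup>2) \<partial>(M \<Otimes>\<^sub>M M))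
        = (\<Sum>(m, n)\<in>{..<H} \<times> {..<H}. (\<integral>x. k m n x \<partial>M) * cnj (\<integral>x. k m n x \<partial>M))"
      by (simp add: case_prod_unfold integral_pair_product[OF k bounded_measurable_cnj[OF k]])
    also have "\<dots> = complex_of_real (\<Sum>(m, n)\<in>{..<H} \<times> {..<H}. (norm (\<integral>x. k m n x \<partial>M))\<^sup>2)"
      by (simp add: case_prod_unfold flip: complex_norm_square)
    finally have "(\<integral>z. (norm (birkhoff_sum S G H z))\<^sup>2 \<partial>(M \<Otimes>\<^sub>M M))
        = (\<Sum>(m, n)\<in>{..<H} \<times> {..<H}. (norm (\<integral>x. k m n x \<partial>M))\<^sup>2)"
      unfolding integral_complex_of_real of_real_eq_iff .
    then show ?thesis by (simp add: norm_divide power_divide)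
  qed
  with lim show ?thesis unfolding k_def by simp
qed

section \<open>The group of iterates of an invertible transformation\<close>

locale invertible_system = prob_space M for M :: "'a measure" +
  fixes T :: "'a \<Rightarrow> 'a"
  assumes invertible: "invertible_mp M T"
begin

abbreviation iter :: "int \<Rightarrow> 'a \<Rightarrow> 'a" where
  "iter \<equiv> iter_int M T"

abbreviation T_inv :: "'a \<Rightarrow> 'a" where
  "T_inv \<equiv> the_inv_into (space M) T"

lemma T_measure_preserving: "measure_preserving_map M T"
  using invertible unfolding invertible_mp_def by blast

lemma T_T_inv: "x \<in> space M \<Longrightarrow> T (T_inv x) = x"
  and T_inv_T: "x \<in> space M \<Longrightarrow> T_inv (T x) = x"
  using invertible unfolding invertible_mp_def
  by (auto simp: bij_betw_def the_inv_into_f_f intro: f_the_inv_into_f)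

lemma T_inv_measure_preserving: "measure_preserving_map M T_inv"
  unfolding measure_preserving_map_def
proof (intro conjI ballI)
  show m [measurable]: "T_inv \<in> M \<rightarrow>\<^sub>M M"
    using invertible unfolding invertible_mp_def by blast
  fix A assume A [measurable]: "A \<in> sets M"
  have "T -` (T_inv -` A \<inter> space M) \<inter> space M = A"
    using T_inv_T measurable_space[OF measure_preserving_measurable[OF T_measure_preserving]]
      sets.sets_into_space[OF A] by auto
  moreover have "T_inv -` A \<inter> space M \<in> sets M" by measurable
  ultimately show "emeasure M (T_inv -` A \<inter> space M) = emeasure M A"
    using T_measure_preserving unfolding measure_preserving_map_def by metis
qed

lemma iter_measure_preserving: "measure_preserving_map M (iter m)"
  unfolding iter_int_def
  by (cases "0 \<le> m") (simp_all add: measure_preserving_funpow T_measure_preserving T_inv_measure_preserving)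

lemma iter_measurable [measurable]: "iter m \<in> M \<rightarrow>\<^sub>M M"
  by (rule measure_preserving_measurable[OF iter_measure_preserving])

lemma iter_space: "x \<in> space M \<Longrightarrow> iter m x \<in> space M"
  by (rule measurable_space[OF iter_measurable])

lemma iter_of_nat: "iter (int m) x = (T ^^ m) x"
  by (simp add: iter_int_def)

lemma iter_succ:
  assumes "x \<in> space M"
  shows "iter (m + 1) x = T (iter m x)"
proof (cases "0 \<le> m")
  case True
  then have "nat (m + 1) = Suc (nat m)" by simp
  with True show ?thesis by (simp add: iter_int_def)
next
  \<comment> \<open>\<open>T\<close> cancels the outermost of the \<open>-m > 0\<close> applications of \<open>T_inv\<close>.\<close>
  case False
  then obtain j where j: "nat (- m) = Suc j" by (cases "nat (- m)") auto
  then have m: "m = - int j - 1" by linarith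
  have "T_inv \<in> M \<rightarrow>\<^sub>M M"
    by (rule measure_preserving_measurable[OF T_inv_measure_preserving])
  then have "(T_inv ^^ j) x \<in> space M"
    using assms by (induction j) (auto dest: measurable_space)
  then show ?thesis
    using False j unfolding m by (auto simp: iter_int_def T_T_inv)
qed

lemma iter_add:
  assumes "x \<in> space M"
  shows "iter (m + n) x = iter m (iter n x)"
proof (induction m rule: int_induct[where k = 0])
  case base
  then show ?case by (simp add: iter_int_def)
next
  case (step1 i)
  then show ?case
    using iter_succ[of x "i + n"] iter_succ[of "iter n x" i] assms
    by (simp add: iter_space add_ac)
next
  case (step2 i)
  have "T (iter (i - 1 + n) x) = T (iter (i - 1) (iter n x))"
    using step2 iter_succ[of x "i - 1 + n"] iter_succ[of "iter n x" "i - 1"] assms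
    by (simp add: iter_space algebra_simps)
  then show ?case
    using T_inv_T iter_space assms by metis
qed

lemma bounded_measurable_iter:
  "bounded_measurable M f \<Longrightarrow> bounded_measurable M (\<lambda>x. f (iter m x))"
  by (rule bounded_measurable_comp) measurable

lemma integral_iter:
  fixes f :: "'a \<Rightarrow> complex"
  shows "f \<in> borel_measurable M \<Longrightarrow> (\<integral>x. f (iter m x) \<partial>M) = (\<integral>x. f x \<partial>M)"
  by (rule measure_preserving_integral[OF iter_measure_preserving])

lemma correlation_shift:
  assumes f: "bounded_measurable M f"
  shows "(\<integral>x. f (iter (m + s) x) * cnj (f (iter (n + s) x)) \<partial>M)
       = (\<integral>x. f (iter m x) * cnj (f (iter n x)) \<partial>M)"
proof -
  have b: "bounded_measurable M (\<lambda>x. f (iter m x) * cnj (f (iter n x)))"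
    by (intro bounded_measurable_intros bounded_measurable_iter f)
  have "(\<integral>x. f (iter (m + s) x) * cnj (f (iter (n + s) x)) \<partial>M)
      = (\<integral>x. f (iter m (iter s x)) * cnj (f (iter n (iter s x))) \<partial>M)"
    by (rule Bochner_Integration.integral_cong) (simp_all add: iter_add)
  also have "\<dots> = (\<integral>x. f (iter m x) * cnj (f (iter n x)) \<partial>M)"
    using bounded_measurable_imp_measurable[OF b] by (rule integral_iter)
  finally show ?thesis .
qed

lemma norm_correlation_multiple:
  assumes f: "bounded_measurable M f"
  shows "norm (\<integral>x. f (iter (p * int m) x) * cnj (f (iter (p * int n) x)) \<partial>M)
       = norm (\<integral>x. f ((T ^^ (nat \<bar>p\<bar> * m)) x) * cnj (f ((T ^^ (nat \<bar>p\<bar> * n)) x)) \<partial>M)"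
proof (cases "0 \<le> p")
  case True
  then have "p * int m = int (nat \<bar>p\<bar> * m)" "p * int n = int (nat \<bar>p\<bar> * n)" by auto
  then show ?thesis by (simp only: iter_of_nat)
next
  \<comment> \<open>Shifting by \<open>-p (m + n)\<close> exchanges the roles of \<open>m\<close> and \<open>n\<close>, and conjugation restores them.\<close>
  case False
  define s where "s = - p * int (m + n)"
  have e: "p * int m + s = int (nat \<bar>p\<bar> * n)" "p * int n + s = int (nat \<bar>p\<bar> * m)"
    using False by (auto simp: s_def algebra_simps)
  have "norm (\<integral>x. f (iter (p * int m) x) * cnj (f (iter (p * int n) x)) \<partial>M)
     = norm (cnj (\<integral>x. f (iter (int (nat \<bar>p\<bar> * n)) x) * cnj (f (iter (int (nat \<bar>p\<bar> * m)) x)) \<partial>M))"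
    by (simp only: correlation_shift[OF f, of "p * int m" s "p * int n", symmetric] e complex_mod_cnj)
  also have "\<dots> = norm (\<integral>x. f (iter (int (nat \<bar>p\<bar> * m)) x) * cnj (f (iter (int (nat \<bar>p\<bar> * n)) x)) \<partial>M)"
    by (subst Bochner_Integration.integral_cnj[symmetric]) (simp add: mult.commute)
  finally show ?thesis by (simp only: iter_of_nat)
qed

text \<open>The correlations at \<open>p m\<close> and \<open>p n\<close> with \<open>m, n < H\<close> are among all correlations at times below
  \<open>\<bar>p\<bar> H\<close>, so their mean of squares is at most \<open>p\<^sup>2\<close> times the mean over all of those. The
  Cauchy--Schwarz inequality passes from squares to absolute values.\<close>

lemma weakly_mixing_correlations:
  assumes wm: "weakly_mixing M T" and f: "bounded_measurable M f"
    and zero: "(\<integral>x. f x \<partial>M) = 0" and p: "p \<noteq> 0"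
  shows "(\<lambda>H. (\<Sum>(m, n)\<in>{..<H} \<times> {..<H}.
      norm (\<integral>x. f (iter (p * int m) x) * cnj (f (iter (p * int n) x)) \<partial>M)) / (real H)\<^sup>2) \<longlonglongrightarrow> 0"
proof -
  define a where "a = nat \<bar>p\<bar>"
  have a: "0 < a" using p by (simp add: a_def)
  define c where "c = (\<lambda>m n. norm (\<integral>x. f ((T ^^ m) x) * cnj (f ((T ^^ n) x)) \<partial>M))"
  define Q where "Q = (\<lambda>H. (\<Sum>(m, n)\<in>{..<H} \<times> {..<H}. (c m n)\<^sup>2) / (real H)\<^sup>2)"
  define D where "D = (\<lambda>H. (\<Sum>(m, n)\<in>{..<H} \<times> {..<H}. c (a * m) (a * n)) / (real H)\<^sup>2)"
  have Q: "Q \<longlonglongrightarrow> 0"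
    unfolding Q_def c_def
    by (rule weakly_mixing_square_correlations[OF prob_space_axioms T_measure_preserving wm f zero])
  have "D H \<le> real a * sqrt (Q (a * H))" if H: "0 < H" for H
  proof (rule power2_le_imp_le)
    have "(\<Sum>(m, n)\<in>{..<H} \<times> {..<H}. c (a * m) (a * n))\<^sup>2
       \<le> (\<Sum>(m, n)\<in>{..<H} \<times> {..<H}. (c (a * m) (a * n))\<^sup>2) * (real H)\<^sup>2"
      using sum_squared_le_sum_of_squares[of "\<lambda>(m, n). c (a * m) (a * n)" "{..<H} \<times> {..<H}"]
      by (simp add: case_prod_unfold power2_eq_square)
    also have "(\<Sum>(m, n)\<in>{..<H} \<times> {..<H}. (c (a * m) (a * n))\<^sup>2)
        = (\<Sum>(m, n)\<in>(\<lambda>(m, n). (a * m, a * n)) ` ({..<H} \<times> {..<H}). (c m n)\<^sup>2)"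
      using a by (subst sum.reindex) (auto simp: inj_on_def case_prod_unfold)
    also have "\<dots> \<le> (\<Sum>(m, n)\<in>{..<a * H} \<times> {..<a * H}. (c m n)\<^sup>2)"
      using a by (intro sum_mono2) auto
    finally have "(\<Sum>(m, n)\<in>{..<H} \<times> {..<H}. c (a * m) (a * n))\<^sup>2
       \<le> (\<Sum>(m, n)\<in>{..<a * H} \<times> {..<a * H}. (c m n)\<^sup>2) * (real H)\<^sup>2"
      by (simp add: mult_right_mono)
    then have "(D H)\<^sup>2 \<le> (real a)\<^sup>2 * Q (a * H)"
      using a H by (simp add: D_def Q_def field_simps power2_eq_square)
    moreover have "0 \<le> Q (a * H)"
      unfolding Q_def by (intro divide_nonneg_nonneg sum_nonneg) auto
    ultimately show "(D H)\<^sup>2 \<le> (real a * sqrt (Q (a * H)))\<^sup>2"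
      by (simp add: power_mult_distrib)
  qed (auto simp: Q_def intro!: mult_nonneg_nonneg divide_nonneg_nonneg sum_nonneg)
  then have ub: "eventually (\<lambda>H. D H \<le> real a * sqrt (Q (a * H))) sequentially"
    by (auto simp: eventually_sequentially intro!: exI[of _ 1])
  have "filterlim (\<lambda>H. a * H) sequentially sequentially"
    using a by (intro filterlim_subseq) (simp add: strict_mono_def)
  from filterlim_compose[OF Q this]
  have "(\<lambda>H. real a * sqrt (Q (a * H))) \<longlonglongrightarrow> real a * sqrt 0"
    by (intro tendsto_intros)
  then have "D \<longlonglongrightarrow> 0"
    by (intro tendsto_sandwich[OF _ ub tendsto_const])
       (auto simp: D_def c_def intro!: always_eventually divide_nonneg_nonneg sum_nonneg)
  then show ?thesis
    unfolding D_def c_def a_def norm_correlation_multiple[OF f] .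
qed

end

section \<open>A van der Corput inequality\<close>

lemma norm_sum_shift_le:
  fixes z :: "nat \<Rightarrow> complex"
  assumes "\<And>n. norm (z n) \<le> B"
  shows "norm ((\<Sum>n=1..N. z n) - (\<Sum>n=1..N. z (n + h))) \<le> 2 * real h * B"
proof (induction h)
  case 0
  then show ?case by simp
next
  case (Suc h)
  have "(\<Sum>n=1..N. z (n + h)) - (\<Sum>n=1..N. z (n + Suc h)) = z (Suc h) - z (Suc N + h)"
    by (induction N) (auto simp: algebra_simps)
  then have "norm ((\<Sum>n=1..N. z (n + h)) - (\<Sum>n=1..N. z (n + Suc h))) \<le> B + B"
    using assms by (metis norm_triangle_le_diff add_mono)
  with Suc have "norm (((\<Sum>n=1..N. z n) - (\<Sum>n=1..N. z (n + h)))
      + ((\<Sum>n=1..N. z (n + h)) - (\<Sum>n=1..N. z (n + Suc h)))) \<le> 2 * real h * B + (B + B)"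
    by (intro norm_triangle_le add_mono)
  then show ?case by (simp add: algebra_simps)
qed

text \<open>Averaging over \<open>H\<close> shifts changes a Cesaro mean by at most \<open>2 H B / N\<close>; the
  Cauchy--Schwarz inequality then moves the square inside the mean over \<open>n\<close>.\<close>

lemma van_der_Corput_pointwise:
  fixes z :: "nat \<Rightarrow> complex"
  assumes z: "\<And>n. norm (z n) \<le> B" and H: "0 < H" and N: "0 < N"
  shows "(norm ((\<Sum>n=1..N. z n) / of_nat N))\<^sup>2
    \<le> 2 * (\<Sum>n=1..N. (norm (\<Sum>h<H. z (n + h)))\<^sup>2) / (real N * (real H)\<^sup>2) + 8 * (real H * B / real N)\<^sup>2"
proof -
  define V where "V = (\<Sum>n=1..N. \<Sum>h<H. z (n + h))"
  have B: "0 \<le> B" using z[of 0] norm_ge_zero order_trans by blast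
  have "norm (of_nat H * (\<Sum>n=1..N. z n) - V)
      = norm (\<Sum>h<H. (\<Sum>n=1..N. z n) - (\<Sum>n=1..N. z (n + h)))"
    unfolding V_def by (subst sum.swap) (simp add: sum_subtractf)
  also have "\<dots> \<le> (\<Sum>h<H. 2 * real H * B)"
  proof (rule sum_norm_le)
    fix h assume "h \<in> {..<H}"
    then have "2 * real h * B \<le> 2 * real H * B" using B by (intro mult_right_mono) auto
    with norm_sum_shift_le[of z B N h, OF z]
    show "norm ((\<Sum>n=1..N. z n) - (\<Sum>n=1..N. z (n + h))) \<le> 2 * real H * B" by linarith
  qed
  also have "\<dots> = real H * (2 * real H * B)" by simp
  finally have E: "norm (of_nat H * (\<Sum>n=1..N. z n) - V) \<le> real H * (2 * real H * B)" .
  have "real H * norm (\<Sum>n=1..N. z n) = norm (V + (of_nat H * (\<Sum>n=1..N. z n) - V))"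
    by (simp add: norm_mult)
  also have "\<dots> \<le> norm V + real H * (2 * real H * B)"
    by (intro norm_triangle_le add_left_mono E)
  finally have "(real H * norm (\<Sum>n=1..N. z n))\<^sup>2 \<le> (norm V + real H * (2 * real H * B))\<^sup>2"
    by (intro power_mono) auto
  also have "\<dots> \<le> 2 * (norm V)\<^sup>2 + 2 * (real H * (2 * real H * B))\<^sup>2"
    using sum_squares_bound[of "norm V" "real H * (2 * real H * B)"] by (simp add: power2_sum)
  also have "(norm V)\<^sup>2 \<le> (\<Sum>n=1..N. norm (\<Sum>h<H. z (n + h)))\<^sup>2"
    unfolding V_def by (intro power_mono norm_sum) auto
  also have "\<dots> \<le> (\<Sum>n=1..N. (norm (\<Sum>h<H. z (n + h)))\<^sup>2) * real N"
    using sum_squared_le_sum_of_squares[of "\<lambda>n. norm (\<Sum>h<H. z (n + h))" "{1..N}"] by simp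
  finally have "(real H * norm (\<Sum>n=1..N. z n))\<^sup>2
     \<le> 2 * ((\<Sum>n=1..N. (norm (\<Sum>h<H. z (n + h)))\<^sup>2) * real N) + 2 * (real H * (2 * real H * B))\<^sup>2"
    by simp
  then have "(real H * norm (\<Sum>n=1..N. z n))\<^sup>2 / (real H * real N)\<^sup>2
     \<le> (2 * ((\<Sum>n=1..N. (norm (\<Sum>h<H. z (n + h)))\<^sup>2) * real N) + 2 * (real H * (2 * real H * B))\<^sup>2)
        / (real H * real N)\<^sup>2"
    by (rule divide_right_mono) simp
  also have "\<dots> = 2 * (\<Sum>n=1..N. (norm (\<Sum>h<H. z (n + h)))\<^sup>2) / (real N * (real H)\<^sup>2)
      + 8 * (real H * B / real N)\<^sup>2"
    using H N by (simp add: field_simps power2_eq_square)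
  also have "(real H * norm (\<Sum>n=1..N. z n))\<^sup>2 / (real H * real N)\<^sup>2
      = (norm ((\<Sum>n=1..N. z n) / of_nat N))\<^sup>2"
    using H N by (simp add: norm_divide power_divide power_mult_distrib)
  finally show ?thesis .
qed

text \<open>Integrating the squared block sums of the pointwise bound and expanding them yields the
  correlations of the sequence.\<close>

lemma (in prob_space) van_der_Corput_mean_square:
  assumes u: "\<And>n. bounded_measurable M (u n)"
    and B: "\<And>n x. x \<in> space M \<Longrightarrow> norm (u n x) \<le> B" and H: "0 < H" and N: "0 < N"
  shows "(\<integral>x. (norm ((\<Sum>n=1..N. u n x) / of_nat N))\<^sup>2 \<partial>M)
    \<le> 2 * norm (\<Sum>(h, k)\<in>{..<H} \<times> {..<H}. (\<Sum>n=1..N. \<integral>x. u (n + h) x * cnj (u (n + k) x) \<partial>M) / of_nat N)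
        / (real H)\<^sup>2 + 8 * (real H * B / real N)\<^sup>2"
proof -
  define W where "W = (\<lambda>x. \<Sum>n=1..N. (norm (\<Sum>h<H. u (n + h) x))\<^sup>2)"
  have iW: "integrable M W"
    unfolding W_def
    by (intro Bochner_Integration.integrable_sum integrable_norm_square bounded_measurable_intros u) auto
  have "complex_of_real ((norm (\<Sum>h<H. u (n + h) x))\<^sup>2)
      = (\<Sum>(h, k)\<in>{..<H} \<times> {..<H}. u (n + h) x * cnj (u (n + k) x))" for n x
    unfolding complex_norm_square cnj_sum sum_product sum.cartesian_product ..
  then have "complex_of_real (W x)
      = (\<Sum>(h, k)\<in>{..<H} \<times> {..<H}. \<Sum>n=1..N. u (n + h) x * cnj (u (n + k) x))" for x
    unfolding W_def of_real_sum case_prod_unfold by (simp only:) (rule sum.swap)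
  then have "(\<integral>x. complex_of_real (W x) \<partial>M)
      = (\<Sum>(h, k)\<in>{..<H} \<times> {..<H}. \<Sum>n=1..N. \<integral>x. u (n + h) x * cnj (u (n + k) x) \<partial>M)"
    by (simp add: case_prod_unfold integrable_bounded_measurable bounded_measurable_intros u)
  then have W: "complex_of_real ((\<integral>x. W x \<partial>M) / real N)
     = (\<Sum>(h, k)\<in>{..<H} \<times> {..<H}. (\<Sum>n=1..N. \<integral>x. u (n + h) x * cnj (u (n + k) x) \<partial>M) / of_nat N)"
    by (simp add: case_prod_unfold sum_divide_distrib)
  have W0: "0 \<le> (\<integral>x. W x \<partial>M)" by (auto simp: W_def intro!: integral_nonneg_AE sum_nonneg)
  have "(\<integral>x. (norm ((\<Sum>n=1..N. u n x) / of_nat N))\<^sup>2 \<partial>M)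
     \<le> (\<integral>x. 2 * W x / (real N * (real H)\<^sup>2) + 8 * (real H * B / real N)\<^sup>2 \<partial>M)"
  proof (rule integral_mono)
    have "bounded_measurable M (\<lambda>x. (\<Sum>n=1..N. u n x) * (1 / of_nat N))"
      by (intro bounded_measurable_intros u) auto
    from integrable_norm_square[OF this]
    show "integrable M (\<lambda>x. (norm ((\<Sum>n=1..N. u n x) / of_nat N))\<^sup>2)" by simp
    show "(norm ((\<Sum>n=1..N. u n x) / of_nat N))\<^sup>2
        \<le> 2 * W x / (real N * (real H)\<^sup>2) + 8 * (real H * B / real N)\<^sup>2" if "x \<in> space M" for x
      unfolding W_def by (rule van_der_Corput_pointwise[OF B[OF that] H N])
  qed (use iW in auto)
  also have "\<dots> = 2 * ((\<integral>x. W x \<partial>M) / real N) / (real H)\<^sup>2 + 8 * (real H * B / real N)\<^sup>2"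
    using iW by (simp add: prob_space)
  also have "(\<integral>x. W x \<partial>M) / real N = norm (complex_of_real ((\<integral>x. W x \<partial>M) / real N))"
    using W0 by (simp only: norm_of_real) simp
  finally show ?thesis unfolding W .
qed

text \<open>For fixed \<open>H\<close> the error term of the preceding inequality disappears as \<open>N\<close> grows, and only the
  limits of the correlations remain. The sequence may change with the length \<open>N\<close> of the average;
  this makes room for the terms \<open>q N\<close> in the exponents.\<close>

lemma (in prob_space) van_der_Corput:
  assumes u: "\<And>N n. bounded_measurable M (u N n)"
    and B: "\<And>N n x. x \<in> space M \<Longrightarrow> norm (u N n x) \<le> B"
    and corr: "\<And>h k. (\<lambda>N. (\<Sum>n=1..N. \<integral>x. u N (n + h) x * cnj (u N (n + k) x) \<partial>M) / of_nat N)
        \<longlonglongrightarrow> \<gamma> h k"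
    and \<gamma>: "(\<lambda>H. (\<Sum>(h, k)\<in>{..<H} \<times> {..<H}. norm (\<gamma> h k)) / (real H)\<^sup>2) \<longlonglongrightarrow> 0"
  shows "(\<lambda>N. \<integral>x. (norm ((\<Sum>n=1..N. u N n x) / of_nat N))\<^sup>2 \<partial>M) \<longlonglongrightarrow> 0"
proof (rule LIMSEQ_I)
  fix e :: real assume e: "e > 0"
  define C where "C = (\<lambda>H N. \<Sum>(h, k)\<in>{..<H} \<times> {..<H}.
     (\<Sum>n=1..N. \<integral>x. u N (n + h) x * cnj (u N (n + k) x) \<partial>M) / of_nat N)"
  obtain H where H: "0 < H" "(\<Sum>(h, k)\<in>{..<H} \<times> {..<H}. norm (\<gamma> h k)) / (real H)\<^sup>2 < e / 2"
  proof -
    have "eventually (\<lambda>H. (\<Sum>(h, k)\<in>{..<H} \<times> {..<H}. norm (\<gamma> h k)) / (real H)\<^sup>2 < e / 2) sequentially"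
      using order_tendstoD(2)[OF \<gamma>, of "e / 2"] e by simp
    then have "eventually (\<lambda>H. 0 < H \<and> (\<Sum>(h, k)\<in>{..<H} \<times> {..<H}. norm (\<gamma> h k)) / (real H)\<^sup>2 < e / 2) sequentially"
      using eventually_gt_at_top[of 0] by eventually_elim simp
    then show ?thesis using that by (auto dest: eventually_happens)
  qed
  have "C H \<longlonglongrightarrow> (\<Sum>(h, k)\<in>{..<H} \<times> {..<H}. \<gamma> h k)"
    unfolding C_def case_prod_unfold by (intro tendsto_sum corr)
  moreover have "(\<lambda>N. real H * B / real N) \<longlonglongrightarrow> 0"
    by (rule lim_const_over_n)
  ultimately have lim: "(\<lambda>N. 2 * norm (C H N) / (real H)\<^sup>2 + 8 * (real H * B / real N)\<^sup>2)
      \<longlonglongrightarrow> 2 * norm (\<Sum>(h, k)\<in>{..<H} \<times> {..<H}. \<gamma> h k) / (real H)\<^sup>2 + 8 * 0\<^sup>2"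
    using H(1) by (intro tendsto_intros) auto
  have "norm (\<Sum>(h, k)\<in>{..<H} \<times> {..<H}. \<gamma> h k) / (real H)\<^sup>2 < e / 2"
    by (rule le_less_trans[OF divide_right_mono H(2)]) (auto simp: case_prod_unfold intro!: norm_sum)
  then have "2 * norm (\<Sum>(h, k)\<in>{..<H} \<times> {..<H}. \<gamma> h k) / (real H)\<^sup>2 + 8 * 0\<^sup>2 < e"
    by (simp add: mult.commute)
  from order_tendstoD(2)[OF lim this] have "eventually (\<lambda>N. norm ((\<integral>x. (norm ((\<Sum>n=1..N. u N n x) / of_nat N))\<^sup>2 \<partial>M) - 0) < e) sequentially"
    using eventually_gt_at_top[of 0]
  proof eventually_elim
    case (elim N)
    have "0 \<le> (\<integral>x. (norm ((\<Sum>n=1..N. u N n x) / of_nat N))\<^sup>2 \<partial>M)"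
      by (rule integral_nonneg_AE) auto
    then show ?case
      using elim van_der_Corput_mean_square[of "u N" B H N, OF u B H(1)] unfolding C_def by simp
  qed
  then show "\<exists>N0. \<forall>N\<ge>N0. norm ((\<integral>x. (norm ((\<Sum>n=1..N. u N n x) / of_nat N))\<^sup>2 \<partial>M) - 0) < e"
    unfolding eventually_sequentially .
qed

section \<open>Multiple averages\<close>

definition (in prob_space) tendsto_mean_square ::
    "(nat \<Rightarrow> 'a \<Rightarrow> complex) \<Rightarrow> complex \<Rightarrow> bool" where
  "tendsto_mean_square A c \<longleftrightarrow> (\<lambda>N. \<integral>x. (norm (A N x - c))\<^sup>2 \<partial>M) \<longlonglongrightarrow> 0"

lemma (in prob_space) tendsto_mean_square_add:
  assumes A: "\<And>N. bounded_measurable M (A N)" "tendsto_mean_square A a"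
    and C: "\<And>N. bounded_measurable M (C N)" "tendsto_mean_square C c"
  shows "tendsto_mean_square (\<lambda>N x. A N x + C N x) (a + c)"
  unfolding tendsto_mean_square_def
proof (rule tendsto_sandwich[OF _ _ tendsto_const])
  let ?D = "\<lambda>N x. 2 * (norm (A N x - a))\<^sup>2 + 2 * (norm (C N x - c))\<^sup>2"
  have iA: "integrable M (\<lambda>x. (norm (A N x - a))\<^sup>2)" for N
    by (intro integrable_norm_square bounded_measurable_intros A)
  have iC: "integrable M (\<lambda>x. (norm (C N x - c))\<^sup>2)" for N
    by (intro integrable_norm_square bounded_measurable_intros C)
  have "(\<integral>x. (norm (A N x + C N x - (a + c)))\<^sup>2 \<partial>M) \<le> (\<integral>x. ?D N x \<partial>M)" for N
  proof (rule integral_mono)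
    show "integrable M (\<lambda>x. (norm (A N x + C N x - (a + c)))\<^sup>2)"
      by (intro integrable_norm_square bounded_measurable_intros A C)
    show "(norm (A N x + C N x - (a + c)))\<^sup>2 \<le> ?D N x" for x
    proof -
      have "(norm ((A N x - a) + (C N x - c)))\<^sup>2 \<le> (norm (A N x - a) + norm (C N x - c))\<^sup>2"
        by (intro power_mono norm_triangle_ineq) auto
      also have "\<dots> \<le> ?D N x"
        using sum_squares_bound[of "norm (A N x - a)" "norm (C N x - c)"] by (simp add: power2_sum)
      finally show ?thesis by (simp only: add_diff_add)
    qed
  qed (use iA iC in auto)
  then show "eventually (\<lambda>N. (\<integral>x. (norm (A N x + C N x - (a + c)))\<^sup>2 \<partial>M)
      \<le> 2 * (\<integral>x. (norm (A N x - a))\<^sup>2 \<partial>M) + 2 * (\<integral>x. (norm (C N x - c))\<^sup>2 \<partial>M)) sequentially"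
    using iA iC by simp
  show "(\<lambda>N. 2 * (\<integral>x. (norm (A N x - a))\<^sup>2 \<partial>M) + 2 * (\<integral>x. (norm (C N x - c))\<^sup>2 \<partial>M)) \<longlonglongrightarrow> 0"
    using tendsto_add[OF tendsto_mult_right_zero[OF A(2)[unfolded tendsto_mean_square_def], of 2]
        tendsto_mult_right_zero[OF C(2)[unfolded tendsto_mean_square_def], of 2]] by simp
qed auto

lemma (in prob_space) tendsto_mean_square_cmult:
  assumes "tendsto_mean_square A a"
  shows "tendsto_mean_square (\<lambda>N x. c * A N x) (c * a)"
proof -
  have "(\<integral>x. (norm (c * A N x - c * a))\<^sup>2 \<partial>M) = (norm c)\<^sup>2 * (\<integral>x. (norm (A N x - a))\<^sup>2 \<partial>M)" for N
    by (simp add: norm_mult power_mult_distrib flip: right_diff_distrib)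
  then show ?thesis
    using tendsto_mult_right_zero[OF assms[unfolded tendsto_mean_square_def], of "(norm c)\<^sup>2"]
    unfolding tendsto_mean_square_def by simp
qed

lemma (in prob_space) tendsto_mean_square_integral_mult:
  assumes A: "\<And>N. bounded_measurable M (A N)" "tendsto_mean_square A a"
    and g: "bounded_measurable M g"
  shows "(\<lambda>N. \<integral>x. g x * A N x \<partial>M) \<longlonglongrightarrow> (\<integral>x. g x \<partial>M) * a"
proof -
  obtain B where B: "0 < B" "\<And>x. x \<in> space M \<Longrightarrow> norm (g x) \<le> B"
    using bounded_measurable_bound[OF g] by blast
  have le: "norm ((\<integral>x. g x * A N x \<partial>M) - (\<integral>x. g x \<partial>M) * a) \<le> B * sqrt (\<integral>x. (norm (A N x - a))\<^sup>2 \<partial>M)" for N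
  proof (rule power2_le_imp_le)
    have d: "bounded_measurable M (\<lambda>x. g x * (A N x - a))"
      by (intro bounded_measurable_intros A g)
    have i1: "integrable M (\<lambda>x. g x * A N x)"
      by (intro integrable_bounded_measurable bounded_measurable_intros A g)
    have i2: "integrable M (\<lambda>x. g x * a)"
      by (intro integrable_bounded_measurable bounded_measurable_intros g)
    have "(\<integral>x. g x * A N x \<partial>M) - (\<integral>x. g x \<partial>M) * a = (\<integral>x. g x * A N x - g x * a \<partial>M)"
      using i1 i2 integrable_bounded_measurable[OF g] by simp
    then have "(norm ((\<integral>x. g x * A N x \<partial>M) - (\<integral>x. g x \<partial>M) * a))\<^sup>2 = (norm (\<integral>x. g x * (A N x - a) \<partial>M))\<^sup>2"
      by (simp only: right_diff_distrib)
    also have "\<dots> \<le> (\<integral>x. (norm (g x * (A N x - a)))\<^sup>2 \<partial>M)"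
      by (rule norm_expectation_square_le[OF d])
    also have "\<dots> \<le> (\<integral>x. B\<^sup>2 * (norm (A N x - a))\<^sup>2 \<partial>M)"
    proof (rule integral_mono[OF integrable_norm_square[OF d]])
      show "integrable M (\<lambda>x. B\<^sup>2 * (norm (A N x - a))\<^sup>2)"
        by (intro integrable_mult_right integrable_norm_square bounded_measurable_intros A)
      show "(norm (g x * (A N x - a)))\<^sup>2 \<le> B\<^sup>2 * (norm (A N x - a))\<^sup>2" if "x \<in> space M" for x
        unfolding norm_mult power_mult_distrib
        by (intro mult_right_mono power_mono B that) simp_all
    qed
    also have "\<dots> = (B * sqrt (\<integral>x. (norm (A N x - a))\<^sup>2 \<partial>M))\<^sup>2"
      by (simp add: power_mult_distrib)
    finally show "(norm ((\<integral>x. g x * A N x \<partial>M) - (\<integral>x. g x \<partial>M) * a))\<^sup>2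
        \<le> (B * sqrt (\<integral>x. (norm (A N x - a))\<^sup>2 \<partial>M))\<^sup>2" .
  qed (use B in \<open>simp add: less_imp_le\<close>)
  have "(\<lambda>N. B * sqrt (\<integral>x. (norm (A N x - a))\<^sup>2 \<partial>M)) \<longlonglongrightarrow> B * sqrt 0"
    using A(2) unfolding tendsto_mean_square_def by (intro tendsto_intros)
  then have "(\<lambda>N. (\<integral>x. g x * A N x \<partial>M) - (\<integral>x. g x \<partial>M) * a) \<longlonglongrightarrow> 0"
    by (intro Lim_null_comparison[OF always_eventually[OF allI[OF le]]]) simp
  then show ?thesis by (simp add: LIM_zero_iff)
qed

context invertible_system
begin

definition multiple_average ::
    "'j set \<Rightarrow> ('j \<Rightarrow> int) \<Rightarrow> ('j \<Rightarrow> int) \<Rightarrow> ('j \<Rightarrow> 'a \<Rightarrow> complex) \<Rightarrow> nat \<Rightarrow> 'a \<Rightarrow> complex" where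
  "multiple_average J p q f N x =
     (\<Sum>n=1..N. \<Prod>j\<in>J. f j (iter (p j * int n + q j * int N) x)) / of_nat N"

lemma bounded_measurable_multiple_average:
  assumes "finite J" "\<And>j. j \<in> J \<Longrightarrow> bounded_measurable M (f j)"
  shows "bounded_measurable M (multiple_average J p q f N)"
proof -
  have "bounded_measurable M (\<lambda>x. (\<Sum>n=1..N. \<Prod>j\<in>J. f j (iter (p j * int n + q j * int N) x)) * (1 / of_nat N))"
    by (intro bounded_measurable_intros bounded_measurable_iter assms) auto
  then show ?thesis unfolding multiple_average_def[abs_def] by simp
qed

text \<open>Applying \<open>T\<close> to the power \<open>-(p\<^sub>k n + q\<^sub>k N)\<close> turns the \<open>k\<close>-th factor into a fixed function
  and the remaining ones into an average with the exponents \<open>p\<^sub>j - p\<^sub>k\<close> and \<open>q\<^sub>j - q\<^sub>k\<close>.\<close>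

lemma integral_average_insert:
  assumes J: "finite J" "k \<notin> J" and F: "\<And>j. j \<in> insert k J \<Longrightarrow> bounded_measurable M (F j)"
  shows "(\<Sum>n=1..N. \<integral>x. (\<Prod>j\<in>insert k J. F j (iter (p j * int n + q j * int N) x)) \<partial>M) / of_nat N
    = (\<integral>x. F k x * multiple_average J (\<lambda>j. p j - p k) (\<lambda>j. q j - q k) F N x \<partial>M)"
proof -
  let ?w = "\<lambda>n x. F k x * (\<Prod>j\<in>J. F j (iter ((p j - p k) * int n + (q j - q k) * int N) x))"
  have w: "bounded_measurable M (?w n)" for n
    using J by (intro bounded_measurable_intros bounded_measurable_iter F) auto
  have "(\<integral>x. (\<Prod>j\<in>insert k J. F j (iter (p j * int n + q j * int N) x)) \<partial>M) = (\<integral>x. ?w n x \<partial>M)" for n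
  proof -
    let ?s = "p k * int n + q k * int N"
    have "(\<Prod>j\<in>insert k J. F j (iter (p j * int n + q j * int N) x)) = ?w n (iter ?s x)"
      if "x \<in> space M" for x
      using J that by (simp add: algebra_simps flip: iter_add)
    then have "(\<integral>x. (\<Prod>j\<in>insert k J. F j (iter (p j * int n + q j * int N) x)) \<partial>M)
        = (\<integral>x. ?w n (iter ?s x) \<partial>M)"
      by (rule Bochner_Integration.integral_cong[OF refl])
    also have "\<dots> = (\<integral>x. ?w n x \<partial>M)"
      using bounded_measurable_imp_measurable[OF w] by (rule integral_iter)
    finally show ?thesis .
  qed
  then have "(\<Sum>n=1..N. \<integral>x. (\<Prod>j\<in>insert k J. F j (iter (p j * int n + q j * int N) x)) \<partial>M)
      = (\<integral>x. (\<Sum>n=1..N. ?w n x) \<partial>M)"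
    by (simp add: integrable_bounded_measurable[OF w])
  moreover have "(\<integral>x. F k x * multiple_average J (\<lambda>j. p j - p k) (\<lambda>j. q j - q k) F N x \<partial>M)
      = (\<integral>x. (\<Sum>n=1..N. ?w n x) / of_nat N \<partial>M)"
    unfolding multiple_average_def by (simp add: sum_distrib_left)
  ultimately show ?thesis by simp
qed

text \<open>The vanishing case of the induction step, where \<open>van_der_Corput\<close> is applied: each
  correlation is, by the preceding lemma, an average over the smaller index set \<open>J\<close>, and its limit
  contains as a factor the correlation of \<open>f k\<close> with itself, which is small on average.\<close>

lemma multiple_average_insert_mean_zero:
  assumes wm: "weakly_mixing M T"
    and IH: "\<And>p q f. inj_on p J \<Longrightarrow> (\<And>j. j \<in> J \<Longrightarrow> p j \<noteq> 0) \<Longrightarrow> (\<And>j. j \<in> J \<Longrightarrow> bounded_measurable M (f j))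
        \<Longrightarrow> tendsto_mean_square (multiple_average J p q f) (\<Prod>j\<in>J. \<integral>x. f j x \<partial>M)"
    and J: "finite J" "k \<notin> J"
    and p: "inj_on p (insert k J)" "p k \<noteq> 0"
    and f: "\<And>j. j \<in> insert k J \<Longrightarrow> bounded_measurable M (f j)"
    and zero: "(\<integral>x. f k x \<partial>M) = 0"
  shows "tendsto_mean_square (multiple_average (insert k J) p q f) 0"
proof -
  let ?J = "insert k J"
  define F where "F = (\<lambda>h h' j x. f j (iter (p j * int h) x) * cnj (f j (iter (p j * int h') x)))"
  define \<gamma> where "\<gamma> = (\<lambda>h h'. (\<integral>x. F h h' k x \<partial>M) * (\<Prod>j\<in>J. \<integral>x. F h h' j x \<partial>M))"
  define u where "u = (\<lambda>N n x. \<Prod>j\<in>?J. f j (iter (p j * int n + q j * int N) x))"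
  have F: "bounded_measurable M (F h h' j)" if "j \<in> ?J" for h h' j
    unfolding F_def by (intro bounded_measurable_intros bounded_measurable_iter f that)
  have "\<forall>j\<in>?J. \<exists>B>0. \<forall>x\<in>space M. norm (f j x) \<le> B"
  proof
    fix j assume "j \<in> ?J"
    from f[OF this] show "\<exists>B>0. \<forall>x\<in>space M. norm (f j x) \<le> B"
      unfolding bounded_measurable_def bounded_pos by simp
  qed
  from bchoice[OF this] obtain b where
    "\<forall>j\<in>?J. 0 < b j \<and> (\<forall>x\<in>space M. norm (f j x) \<le> b j)" ..
  then have b: "0 < b j" "x \<in> space M \<Longrightarrow> norm (f j x) \<le> b j" if "j \<in> ?J" for j x
    using that by auto
  have u_bound: "norm (u N n x) \<le> (\<Prod>j\<in>?J. b j)" if "x \<in> space M" for N n x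
    unfolding u_def prod_norm[symmetric] by (intro prod_mono) (auto intro!: b(2) iter_space that)
  have "(\<lambda>N. \<integral>x. (norm ((\<Sum>n=1..N. u N n x) / of_nat N))\<^sup>2 \<partial>M) \<longlonglongrightarrow> 0"
  proof (rule van_der_Corput[OF _ u_bound])
    show "bounded_measurable M (u N n)" for N n
      unfolding u_def using J by (intro bounded_measurable_intros bounded_measurable_iter f) auto
    show "(\<lambda>N. (\<Sum>n=1..N. \<integral>x. u N (n + h) x * cnj (u N (n + h') x) \<partial>M) / of_nat N) \<longlonglongrightarrow> \<gamma> h h'" for h h'
    proof -
      have "(\<integral>x. u N (n + h) x * cnj (u N (n + h') x) \<partial>M)
        = (\<integral>x. (\<Prod>j\<in>?J. F h h' j (iter (p j * int n + q j * int N) x)) \<partial>M)" for N n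
      proof (rule Bochner_Integration.integral_cong[OF refl])
        fix x assume x: "x \<in> space M"
        have "p j * int (n + i) + q j * int N = p j * int i + (p j * int n + q j * int N)" for i j
          by (simp add: algebra_simps)
        then show "u N (n + h) x * cnj (u N (n + h') x)
            = (\<Prod>j\<in>?J. F h h' j (iter (p j * int n + q j * int N) x))"
          by (simp only: u_def F_def prod.distrib cnj_prod iter_add[OF x])
      qed
      moreover have "(\<lambda>N. \<integral>x. F h h' k x * multiple_average J (\<lambda>j. p j - p k) (\<lambda>j. q j - q k) (F h h') N x \<partial>M)
          \<longlonglongrightarrow> \<gamma> h h'"
        unfolding \<gamma>_def
      proof (rule tendsto_mean_square_integral_mult)
        show "tendsto_mean_square (multiple_average J (\<lambda>j. p j - p k) (\<lambda>j. q j - q k) (F h h'))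
            (\<Prod>j\<in>J. \<integral>x. F h h' j x \<partial>M)"
          using p(1) J(2) by (intro IH F) (auto simp: inj_on_def)
      qed (use J F in \<open>auto intro!: bounded_measurable_multiple_average\<close>)
      ultimately show ?thesis
        by (simp only: integral_average_insert[OF J F])
    qed
    \<comment> \<open>Only the \<open>k\<close>-th factor of the limit becomes small; the others are merely bounded.\<close>
    define C where "C = (\<Prod>j\<in>J. (b j)\<^sup>2)"
    have "norm (\<gamma> h h') \<le> norm (\<integral>x. F h h' k x \<partial>M) * C" for h h'
    proof -
      have "norm (\<integral>x. F h h' j x \<partial>M) \<le> (b j)\<^sup>2" if j: "j \<in> J" for j
      proof -
        have "norm (\<integral>x. F h h' j x \<partial>M) \<le> (\<integral>x. norm (F h h' j x) \<partial>M)"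
          by (rule integral_norm_bound)
        also have "\<dots> \<le> (\<integral>x. (b j)\<^sup>2 \<partial>M)"
        proof (rule integral_mono)
          show "norm (F h h' j x) \<le> (b j)\<^sup>2" if "x \<in> space M" for x
            using j b[of j] that unfolding F_def norm_mult power2_eq_square complex_mod_cnj
            by (intro mult_mono) (auto simp: iter_space less_imp_le)
        qed (use j F in \<open>auto intro!: integrable_norm integrable_bounded_measurable\<close>)
        finally show ?thesis by (simp add: prob_space)
      qed
      then show ?thesis
        unfolding \<gamma>_def C_def norm_mult prod_norm[symmetric]
        by (intro mult_left_mono prod_mono) auto
    qed
    then have le: "(\<Sum>(h, h')\<in>{..<H} \<times> {..<H}. norm (\<gamma> h h')) / (real H)\<^sup>2
        \<le> (\<Sum>(h, h')\<in>{..<H} \<times> {..<H}. norm (\<integral>x. F h h' k x \<partial>M)) / (real H)\<^sup>2 * C" for H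
      unfolding times_divide_eq_left case_prod_unfold sum_distrib_right
      by (intro divide_right_mono sum_mono) simp_all
    have lim: "(\<lambda>H. (\<Sum>(h, h')\<in>{..<H} \<times> {..<H}. norm (\<integral>x. F h h' k x \<partial>M)) / (real H)\<^sup>2 * C) \<longlonglongrightarrow> 0"
      unfolding F_def
      by (intro tendsto_mult_left_zero weakly_mixing_correlations wm f zero p(2)) auto
    show "(\<lambda>H. (\<Sum>(h, h')\<in>{..<H} \<times> {..<H}. norm (\<gamma> h h')) / (real H)\<^sup>2) \<longlonglongrightarrow> 0"
    proof (rule tendsto_sandwich[OF _ always_eventually[OF allI[OF le]] tendsto_const])
      show "eventually (\<lambda>H. 0 \<le> (\<Sum>(h, h')\<in>{..<H} \<times> {..<H}. norm (\<gamma> h h')) / (real H)\<^sup>2) sequentially"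
        by (auto intro!: always_eventually divide_nonneg_nonneg sum_nonneg)
    qed (rule lim)
  qed
  then show ?thesis
    unfolding tendsto_mean_square_def multiple_average_def u_def by simp
qed

text \<open>Splitting \<open>f k\<close> into its mean and a function of mean zero reduces the index set \<open>insert k J\<close>
  to the vanishing case and to \<open>J\<close>.\<close>

lemma multiple_average_tendsto:
  assumes wm: "weakly_mixing M T" and "finite J"
    and "inj_on p J" "\<And>j. j \<in> J \<Longrightarrow> p j \<noteq> 0" "\<And>j. j \<in> J \<Longrightarrow> bounded_measurable M (f j)"
  shows "tendsto_mean_square (multiple_average J p q f) (\<Prod>j\<in>J. \<integral>x. f j x \<partial>M)"
  using assms(2-)
proof (induction J arbitrary: p q f rule: finite_induct)
  case empty
  \<comment> \<open>The empty product averages to one, except for \<open>N = 0\<close>, where the quotient is zero.\<close>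
  have "eventually (\<lambda>N. (\<integral>x. (norm (multiple_average {} p q f N x - 1))\<^sup>2 \<partial>M) = 0) sequentially"
    using eventually_gt_at_top[of 0] by eventually_elim (simp add: multiple_average_def)
  then show ?case
    unfolding tendsto_mean_square_def by (simp add: tendsto_eventually)
next
  case (insert k J)
  define c where "c = (\<integral>x. f k x \<partial>M)"
  define f0 where "f0 = f(k := \<lambda>x. f k x - c)"
  have f: "bounded_measurable M (f j)" if "j \<in> insert k J" for j
    using insert.prems(3)[OF that] .
  have f0: "bounded_measurable M (f0 j)" if "j \<in> insert k J" for j
    using that f by (auto simp: f0_def intro!: bounded_measurable_intros)
  have "(\<integral>x. f0 k x \<partial>M) = 0"
    using integrable_bounded_measurable[OF f, of k] by (simp add: f0_def c_def prob_space)
  then have 1: "tendsto_mean_square (multiple_average (insert k J) p q f0) 0"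
    using insert.hyps insert.prems f0
    by (intro multiple_average_insert_mean_zero[OF wm insert.IH]) auto
  have "tendsto_mean_square (multiple_average J p q f) (\<Prod>j\<in>J. \<integral>x. f j x \<partial>M)"
    using insert.prems by (intro insert.IH) (auto simp: inj_on_def)
  from tendsto_mean_square_add[OF bounded_measurable_multiple_average 1
      bounded_measurable_mult[OF bounded_measurable_const bounded_measurable_multiple_average]
      tendsto_mean_square_cmult[OF this, of c]]
  have "tendsto_mean_square (\<lambda>N x. multiple_average (insert k J) p q f0 N x + c * multiple_average J p q f N x)
     (0 + c * (\<Prod>j\<in>J. \<integral>x. f j x \<partial>M))"
    using f f0 insert.hyps by simp
  moreover have "multiple_average (insert k J) p q f N x
      = multiple_average (insert k J) p q f0 N x + c * multiple_average J p q f N x" for N x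
  proof -
    have "(\<Prod>j\<in>insert k J. f j (iter (p j * int n + q j * int N) x))
       = (\<Prod>j\<in>insert k J. f0 j (iter (p j * int n + q j * int N) x))
         + c * (\<Prod>j\<in>J. f j (iter (p j * int n + q j * int N) x))" for n
    proof -
      have "(\<Prod>j\<in>J. f0 j (iter (p j * int n + q j * int N) x))
          = (\<Prod>j\<in>J. f j (iter (p j * int n + q j * int N) x))"
        using insert.hyps by (intro prod.cong) (auto simp: f0_def)
      then show ?thesis
        using insert.hyps by (simp add: algebra_simps) (simp add: f0_def algebra_simps)
    qed
    then show ?thesis
      unfolding multiple_average_def
      by (simp only: sum.distrib sum_distrib_left[symmetric] add_divide_distrib times_divide_eq_right)
  qed
  ultimately show ?case
    using insert.hyps by (simp add: c_def)
qed

end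

theorem theorem2p1:
  fixes M :: "'a measure" and T :: "'a \<Rightarrow> 'a"
    and l :: nat and f :: "nat \<Rightarrow> 'a \<Rightarrow> complex" and p q :: "nat \<Rightarrow> int"
  assumes "separable_prob_space M"
    and "invertible_mp M T"
    and "weakly_mixing M T"
    and "l \<ge> 1"
    and "\<And>j. j \<in> {1..l} \<Longrightarrow> bounded_measurable M (f j)"
    and "inj_on p {1..l}"
    and "\<And>j. j \<in> {1..l} \<Longrightarrow> p j \<noteq> 0"
  shows "converges_in_L2 M
     (\<lambda>N x. (1 / of_nat N) *
        (\<Sum>n = 1..N. \<Prod>j = 1..l. koopman M T (p j * int n + q j * int N) (f j) x))
     (\<lambda>x. \<Prod>j = 1..l. \<integral>y. f j y \<partial>M)"
proof -
  interpret prob_space M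
    using assms(1) unfolding separable_prob_space_def by blast
  interpret invertible_system M T
    by unfold_locales (rule assms(2))
  have in_L2: "in_L2 M g" if "bounded_measurable M g" for g
    using that integrable_norm_square[OF that] unfolding in_L2_def by auto
  have average: "(\<lambda>N x. (1 / of_nat N) *
        (\<Sum>n = 1..N. \<Prod>j = 1..l. koopman M T (p j * int n + q j * int N) (f j) x))
     = multiple_average {1..l} p q f"
    by (intro ext) (simp add: multiple_average_def koopman_def)
  have "(\<lambda>N. L2_norm M (\<lambda>x. multiple_average {1..l} p q f N x - (\<Prod>j = 1..l. \<integral>y. f j y \<partial>M)))
      \<longlonglongrightarrow> sqrt 0"
    using multiple_average_tendsto[OF assms(3) _ assms(6,7,5)]
    unfolding L2_norm_def tendsto_mean_square_def by (intro tendsto_real_sqrt) auto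
  then show ?thesis
    unfolding average converges_in_L2_def
    using assms(5) by (auto intro!: in_L2 bounded_measurable_multiple_average bounded_measurable_const)
qed

end
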